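(* Let $p>q>1$ be coprime integers. Then $\Phi:\Xi_{p/q}\to Y_{p/q}$ is a conjugacy; that is, $\Phi$ restricts to a continuous bijection from $\Xi_{p/q}$ onto $Y_{p/q}$ that commutes with the shift maps.
   Context: For $n\ge 2$ let $\Sigma_n=\{0,1,\dots,n-1\}$. For a finite alphabet $A$, $A^{\mathbb{Z}}$ carries the product topology, and $\sigma(x)[i]=x[i+1]$ is the shift map. A subshift is a nonempty closed $X\subseteq A^{\mathbb{Z}}$ with $\sigma(X)=X$. For coprime integers $s,t>1$, write $a,b\in\Sigma_{st}$ uniquely as $a=a_1t+a_0$, $b=b_1t+b_0$ with $a_0,b_0\in\Sigma_t$, $a_1,b_1\in\Sigma_s$, and put $g_{s,st}(a,b)=a_0s+b_1$. Let $f_{s/t,st}(a,c,b)=g_{s,st}(g_{s,st}(a,c),g_{s,st}(c,b))$. The multiplication automaton $\Pi_{s/t,st}:\Sigma_{st}^{\mathbb{Z}}\to\Sigma_{st}^{\mathbb{Z}}$ is $\Pi_{s/t,st}(x)[i]=f_{s/t,st}(x[i-1],x[i],x[i+1])$; it is a bijection with inverse $\Pi_{t/s,st}$ and it multiplies by $s/t$ in base $st$. The trace of $x\in\Sigma_{st}^{\mathbb{Z}}$ is $\mathrm{Tr}_{s/t}(x)\in\Sigma_{st}^{\mathbb{Z}}$, $\mathrm{Tr}_{s/t}(x)[k]=\Pi_{s/t,st}^k(x)[0]$ for $k\in\mathbb{Z}$, and the trace subshift is $\Xi_{s/t}=\mathrm{Tr}_{s/t}(\Sigma_{st}^{\mathbb{Z}})$.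 Let $\Sigma_{-q,p}=\{-(q-1),\dots,0,1,\dots,p-1\}$. For a real $\xi>0$ let $\psi_{p/q}(\xi)=q\lfloor\frac{p}{q}\xi\rfloor-p\lfloor\xi\rfloor\in\Sigma_{-q,p}$, and let $\varphi_{p/q}(\xi)\in\Sigma_{-q,p}^{\mathbb{Z}}$ be given by $\varphi_{p/q}(\xi)[i]=\psi_{p/q}((p/q)^i\xi)$ for $i\in\mathbb{Z}$ (the companion $p/q$-representation of $\xi$). $Y_{p/q}$ is the subshift defined as the topological closure of $\varphi_{p/q}(\mathbb{R}_{>0})$ in $\Sigma_{-q,p}^{\mathbb{Z}}$. For $n>1$ and $m\in\mathbb{Z}$, $\mathrm{Md}_n(m)=m-n\lfloor m/n\rfloor$ is the remainder of $m$ modulo $n$. For $x\in\Sigma_{pq}^{\mathbb{Z}}$, $\Phi(x)$ is the bi-infinite integer sequence $\Phi(x)[i]=q\,\mathrm{Md}_p(x[i+1])-p\,\mathrm{Md}_q(x[i])$, $i\in\mathbb{Z}$. *)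

theory Defs
  imports "HOL-Analysis.Analysis"
begin

text \<open>
  Alphabets are finite sets of integers and bi-infinite sequences are functions on \<^typ>\<open>int\<close>.
  The carrier \<^term>\<open>topspace (full_shift A)\<close> is the set of all sequences with values in \<^term>\<open>A\<close>.
\<close>

definition full_shift :: "'a set \<Rightarrow> (int \<Rightarrow> 'a) topology" where
  "full_shift A = product_topology (\<lambda>_. discrete_topology A) UNIV"

definition shift :: "(int \<Rightarrow> 'a) \<Rightarrow> int \<Rightarrow> 'a" where
  "shift x = (\<lambda>i. x (i + 1))"

definition conjugacy ::
  "'a set \<Rightarrow> (int \<Rightarrow> 'a) set \<Rightarrow> 'b set \<Rightarrow> (int \<Rightarrow> 'b) set \<Rightarrow> ((int \<Rightarrow> 'a) \<Rightarrow> (int \<Rightarrow> 'b)) \<Rightarrow> bool" where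
  "conjugacy A X B Y F \<longleftrightarrow>
     X \<subseteq> topspace (full_shift A) \<and> Y \<subseteq> topspace (full_shift B) \<and>
     continuous_map (subtopology (full_shift A) X) (subtopology (full_shift B) Y) F \<and>
     bij_betw F X Y \<and>
     (\<forall>x\<in>X. F (shift x) = shift (F x))"

definition digits :: "int \<Rightarrow> int set" where
  "digits n = {0..<n}"

text \<open>
  The digits of \<open>a = a\<^sub>1 t + a\<^sub>0\<close> with \<open>0 \<le> a\<^sub>0 < t\<close> are \<open>a\<^sub>1 = a div t\<close> and \<open>a\<^sub>0 = a mod t\<close>.
  The parameters of \<open>mult_g\<close>, \<open>mult_f\<close> and \<open>mult_automaton\<close> are \<open>s\<close> and \<open>t\<close>; the base is \<open>s t\<close>.
\<close>

definition mult_g :: "int \<Rightarrow> int \<Rightarrow> int \<Rightarrow> int \<Rightarrow> int" where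
  "mult_g s t a b = (a mod t) * s + b div t"

definition mult_f :: "int \<Rightarrow> int \<Rightarrow> int \<Rightarrow> int \<Rightarrow> int \<Rightarrow> int" where
  "mult_f s t a c b = mult_g s t (mult_g s t a c) (mult_g s t c b)"

definition mult_automaton :: "int \<Rightarrow> int \<Rightarrow> (int \<Rightarrow> int) \<Rightarrow> int \<Rightarrow> int" where
  "mult_automaton s t x = (\<lambda>i. mult_f s t (x (i - 1)) (x i) (x (i + 1)))"

text \<open>
  Integer iterates of a bijection of \<^term>\<open>S\<close>; the inverse is that of the restriction to \<^term>\<open>S\<close>.
\<close>

definition int_iterate :: "'a set \<Rightarrow> ('a \<Rightarrow> 'a) \<Rightarrow> int \<Rightarrow> 'a \<Rightarrow> 'a" where
  "int_iterate S F k =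
     (if 0 \<le> k then F ^^ nat k else inv_into S F ^^ nat (- k))"

definition trace_seq :: "int \<Rightarrow> int \<Rightarrow> (int \<Rightarrow> int) \<Rightarrow> int \<Rightarrow> int" where
  "trace_seq s t x =
     (\<lambda>k. int_iterate (topspace (full_shift (digits (s * t)))) (mult_automaton s t) k x 0)"

definition trace_subshift :: "int \<Rightarrow> int \<Rightarrow> (int \<Rightarrow> int) set" where
  "trace_subshift s t = trace_seq s t ` topspace (full_shift (digits (s * t)))"

definition signed_digits :: "int \<Rightarrow> int \<Rightarrow> int set" where
  "signed_digits p q = {- (q - 1)..p - 1}"

definition companion_digit :: "int \<Rightarrow> int \<Rightarrow> real \<Rightarrow> int" where
  "companion_digit p q \<xi> = q * \<lfloor>(of_int p / of_int q) * \<xi>\<rfloor> - p * \<lfloor>\<xi>\<rfloor>"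

definition companion_rep :: "int \<Rightarrow> int \<Rightarrow> real \<Rightarrow> int \<Rightarrow> int" where
  "companion_rep p q \<xi> = (\<lambda>i. companion_digit p q ((of_int p / of_int q) powi i * \<xi>))"

definition companion_subshift :: "int \<Rightarrow> int \<Rightarrow> (int \<Rightarrow> int) set" where
  "companion_subshift p q =
     full_shift (signed_digits p q) closure_of (companion_rep p q ` {0<..})"

definition Phi :: "int \<Rightarrow> int \<Rightarrow> (int \<Rightarrow> int) \<Rightarrow> int \<Rightarrow> int" where
  "Phi p q x = (\<lambda>i. q * (x (i + 1) mod p) - p * (x i mod q))"

end

theory Submission
  imports Defs
begin

text \<open>
  If \<open>x\<close> is the base-\<open>pq\<close> expansion of a real \<open>\<xi> > 0\<close>, then the trace of \<open>x\<close> at \<open>k\<close> is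
  \<open>\<lfloor>(p/q)\<^sup>k \<xi>\<rfloor> mod pq\<close>, and \<open>\<Phi>\<close> maps this trace to the companion representation of \<open>\<xi>\<close>, because
  \<open>\<lfloor>\<xi>\<^sub>k\<^sub>+\<^sub>1 / p\<rfloor> = \<lfloor>\<xi>\<^sub>k / q\<rfloor>\<close> for \<open>\<xi>\<^sub>k = (p/q)\<^sup>k \<xi>\<close>. Such expansions are dense in the full shift, so by
  compactness the continuous map \<open>\<Phi> \<circ> Tr\<close> sends the full shift onto the closure of the companion
  representations. Injectivity is the Chinese remainder theorem: \<open>\<Phi>(y)[i]\<close> determines
  \<open>y[i] mod q\<close> and \<open>y[i+1] mod p\<close>.
\<close>

section \<open>Full shifts\<close>

lemma topspace_full_shift_iff: "x \<in> topspace (full_shift A) \<longleftrightarrow> (\<forall>i. x i \<in> A)"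
  by (auto simp: full_shift_def PiE_iff)

lemma compact_full_shift:
  assumes "finite A" shows "compact_space (full_shift A)"
  using assms by (simp add: full_shift_def compact_space_product_topology compact_space_discrete_topology)

lemma Hausdorff_full_shift: "Hausdorff_space (full_shift A)"
  by (simp add: full_shift_def Hausdorff_space_product_topology Hausdorff_space_discrete_topology)

lemma openin_cylinder:
  fixes x :: "int \<Rightarrow> 'a"
  assumes "finite J"
  shows "openin (full_shift A) {y \<in> topspace (full_shift A). \<forall>j\<in>J. y j = x j}"
proof -
  \<comment> \<open>Intersecting with \<open>A\<close> keeps the factor inside the alphabet when
    \<open>x j\<close> lies outside it; the cylinder is then empty.\<close>
  have "{y \<in> topspace (full_shift A). \<forall>j\<in>J. y j = x j}
      = PiE UNIV (\<lambda>j. if j \<in> J then A \<inter> {x j} else A)"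
    by (auto simp: topspace_full_shift_iff PiE_iff split: if_splits)
  moreover have "finite {j. (if j \<in> J then A \<inter> {x j} else A) \<noteq> A}"
    by (rule finite_subset[OF _ assms]) auto
  ultimately show ?thesis
    unfolding full_shift_def
    by (auto simp: openin_PiE_gen)
qed

lemma cylinder_in_open:
  assumes "openin (full_shift A) T" "x \<in> T"
  obtains J where "finite J" "\<And>y. y \<in> topspace (full_shift A) \<Longrightarrow> \<forall>j\<in>J. y j = x j \<Longrightarrow> y \<in> T"
proof -
  obtain U where U: "finite {i. U i \<noteq> A}" "\<And>i. U i \<subseteq> A" "x \<in> PiE UNIV U" "PiE UNIV U \<subseteq> T"
    using assms unfolding full_shift_def openin_product_topology_alt by auto
  show thesis
  proof (rule that[OF U(1)])
    fix y assume y: "y \<in> topspace (full_shift A)" "\<forall>j\<in>{i. U i \<noteq> A}. y j = x j"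
    have "y i \<in> U i" for i
      using y U(3) by (cases "U i = A") (auto simp: topspace_full_shift_iff PiE_iff)
    then show "y \<in> T" using U(4) by (auto simp: PiE_iff)
  qed
qed

text \<open>The preimage of a set of symbols under coordinate \<open>i\<close> is a union of
  cylinders over the window \<open>J\<close>. The criterion serves both the automaton and
  \<open>Phi\<close>.\<close>

lemma continuous_map_local:
  assumes X: "X \<subseteq> topspace (full_shift A)"
    and maps: "\<And>x i. x \<in> X \<Longrightarrow> F x i \<in> B"
    and "local": "\<And>i. \<exists>J. finite J \<and> (\<forall>x\<in>X. \<forall>y\<in>X. (\<forall>j\<in>J. x j = y j) \<longrightarrow> F x i = F y i)"
  shows "continuous_map (subtopology (full_shift A) X) (full_shift B) F"
proof -
  have "continuous_map (subtopology (full_shift A) X) (discrete_topology B) (\<lambda>x. F x i)" for i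
  proof -
    obtain J where J: "finite J" "\<And>x y. x \<in> X \<Longrightarrow> y \<in> X \<Longrightarrow> \<forall>j\<in>J. x j = y j \<Longrightarrow> F x i = F y i"
      using "local"[of i] by auto
    have "openin (subtopology (full_shift A) X) {x \<in> X. F x i \<in> U}" for U
    proof -
      let ?C = "\<lambda>x. {y \<in> topspace (full_shift A). \<forall>j\<in>J. y j = x j}"
      have "{x \<in> X. F x i \<in> U} = (\<Union>x\<in>{x \<in> X. F x i \<in> U}. ?C x) \<inter> X"
      proof (intro set_eqI iffI)
        fix x assume "x \<in> {x \<in> X. F x i \<in> U}"
        then show "x \<in> (\<Union>x\<in>{x \<in> X. F x i \<in> U}. ?C x) \<inter> X" using X by blast
      next
        fix y assume "y \<in> (\<Union>x\<in>{x \<in> X. F x i \<in> U}. ?C x) \<inter> X"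
        then obtain x where "x \<in> X" "F x i \<in> U" "y \<in> X" "\<forall>j\<in>J. y j = x j" by blast
        then show "y \<in> {x \<in> X. F x i \<in> U}" using J(2)[of y x] by simp
      qed
      moreover have "openin (full_shift A) (\<Union>x\<in>{x \<in> X. F x i \<in> U}. ?C x)"
        using openin_cylinder[OF J(1)] by blast
      ultimately show ?thesis
        unfolding openin_subtopology by blast
    qed
    then show ?thesis
      using X maps by (auto simp: continuous_map_def Int_absorb1)
  qed
  then show ?thesis
    by (simp add: full_shift_def continuous_map_componentwise_UNIV)
qed

lemma continuous_map_funpow:
  assumes "continuous_map X X f" shows "continuous_map X X (f ^^ k)"
proof (induction k)
  case (Suc k)
  then show ?case using continuous_map_compose[OF Suc assms] by (simp add: o_def)
qed simp

section \<open>The multiplication automaton\<close>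

text \<open>\<open>mult_g\<close> reads digits split with respect to \<open>t\<close> and writes its
  output split with respect to \<open>s\<close>; this exchange is what lets the automaton with
  swapped parameters undo it.\<close>

lemma mult_g_digit:
  assumes "s > 0" "t > 0" "b \<in> digits (s * t)"
  shows "mult_g s t a b \<in> digits (s * t)"
    and "mult_g s t a b div s = a mod t"
    and "mult_g s t a b mod s = b div t"
proof -
  have "b div t * t \<le> b"
    using assms(2) minus_mod_eq_div_mult[of b t] pos_mod_sign[of t b] by linarith
  also have "b < s * t" using assms(3) by (simp add: digits_def)
  finally have b: "0 \<le> b div t" "b div t < s"
    using assms by (auto simp: digits_def pos_imp_zdiv_nonneg_iff)
  have "a mod t + 1 \<le> t" using assms by (simp add: add1_zle_eq)
  then have "(a mod t + 1) * s \<le> t * s"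
    using assms by (intro mult_right_mono) auto
  then show "mult_g s t a b \<in> digits (s * t)"
    using b assms by (auto simp: digits_def mult_g_def algebra_simps)
  show "mult_g s t a b div s = a mod t" "mult_g s t a b mod s = b div t"
    using b assms(1) by (auto simp: mult_g_def)
qed

text \<open>Both inner values retain half of \<open>b\<close>: the first has \<open>b div t\<close>
  as remainder modulo \<open>s\<close>, the second has \<open>b mod t\<close> as quotient by
  \<open>s\<close>. The outer map reassembles \<open>b\<close>.\<close>

lemma mult_g_cancel:
  assumes "s > 0" "t > 0" "b \<in> digits (s * t)" "c \<in> digits (s * t)"
  shows "mult_g t s (mult_g s t a b) (mult_g s t b c) = b"
  using mult_g_digit[OF assms(1-3)] mult_g_digit[OF assms(1,2,4)]
  by (simp add: mult_g_def[of t s])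

lemma mult_automaton_digit:
  assumes "s > 0" "t > 0" "x \<in> topspace (full_shift (digits (s * t)))"
  shows "mult_automaton s t x \<in> topspace (full_shift (digits (s * t)))"
  using assms by (auto simp: topspace_full_shift_iff mult_automaton_def mult_f_def
      intro!: mult_g_digit)

lemma mult_automaton_cancel:
  assumes "s > 0" "t > 0" and x: "x \<in> topspace (full_shift (digits (s * t)))"
  shows "mult_automaton t s (mult_automaton s t x) = x"
proof
  fix i
  have x: "x j \<in> digits (s * t)" for j using x by (simp add: topspace_full_shift_iff)
  have g: "mult_g s t (x j) (x k) \<in> digits (s * t)" for j k
    using mult_g_digit assms x by blast
  \<comment> \<open>Cancellation acts twice: the inner layers reduce to
    \<open>mult_g s t (x (i - 1)) (x i)\<close> and \<open>mult_g s t (x i) (x (i + 1))\<close>, and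
    the outer layer reduces these to \<open>x i\<close>.\<close>
  show "mult_automaton t s (mult_automaton s t x) i = x i"
    using assms by (simp add: mult_automaton_def mult_f_def mult_g_cancel x g)
qed

lemma bij_mult_automaton:
  assumes "s > 0" "t > 0"
  defines "S \<equiv> topspace (full_shift (digits (s * t)))"
  shows "bij_betw (mult_automaton s t) S S"
    and "x \<in> S \<Longrightarrow> inv_into S (mult_automaton s t) x = mult_automaton t s x"
proof -
  have S: "S = topspace (full_shift (digits (t * s)))" by (simp add: S_def mult.commute)
  have st: "mult_automaton s t x \<in> S" "mult_automaton t s (mult_automaton s t x) = x" if "x \<in> S" for x
    using that mult_automaton_digit[OF assms(1,2)] mult_automaton_cancel[OF assms(1,2)]
    by (simp_all add: S_def)
  have ts: "mult_automaton t s x \<in> S" "mult_automaton s t (mult_automaton t s x) = x" if "x \<in> S" for x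
    using that mult_automaton_digit[OF assms(2,1)] mult_automaton_cancel[OF assms(2,1)]
    by (simp_all add: S)
  show bij: "bij_betw (mult_automaton s t) S S"
    by (rule bij_betw_byWitness[where f' = "mult_automaton t s"]) (auto simp: st ts)
  assume "x \<in> S"
  from ts[OF this] show "inv_into S (mult_automaton s t) x = mult_automaton t s x"
    using bij by (intro inv_into_f_eq) (auto simp: bij_betw_def)
qed

lemma continuous_mult_automaton:
  assumes "s > 0" "t > 0"
  shows "continuous_map (full_shift (digits (s * t))) (full_shift (digits (s * t))) (mult_automaton s t)"
proof -
  let ?A = "digits (s * t)"
  have "continuous_map (subtopology (full_shift ?A) (topspace (full_shift ?A))) (full_shift ?A)
      (mult_automaton s t)"
  proof (rule continuous_map_local)
    show "mult_automaton s t x i \<in> ?A" if "x \<in> topspace (full_shift ?A)" for x i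
      using mult_automaton_digit[OF assms that] by (simp add: topspace_full_shift_iff)
    show "\<exists>J. finite J \<and> (\<forall>x\<in>topspace (full_shift ?A). \<forall>y\<in>topspace (full_shift ?A).
        (\<forall>j\<in>J. x j = y j) \<longrightarrow> mult_automaton s t x i = mult_automaton s t y i)" for i
      by (rule exI[of _ "{i - 1, i, i + 1}"]) (simp add: mult_automaton_def)
  qed simp
  then show ?thesis by simp
qed

section \<open>Integer iterates and continuity of the trace map\<close>

lemma continuous_int_iterate:
  assumes "s > 0" "t > 0"
  defines "S \<equiv> topspace (full_shift (digits (s * t)))"
  shows "continuous_map (full_shift (digits (s * t))) (full_shift (digits (s * t)))
    (int_iterate S (mult_automaton s t) k)"
proof -
  \<comment> \<open>On the full shift the inverse agrees with the automaton for swapped parameters,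
    so negative iterates are continuous as well.\<close>
  have "continuous_map (full_shift (digits (s * t))) (full_shift (digits (s * t)))
      (inv_into S (mult_automaton s t))"
  proof (rule continuous_map_eq)
    show "continuous_map (full_shift (digits (s * t))) (full_shift (digits (s * t))) (mult_automaton t s)"
      using continuous_mult_automaton[OF assms(2,1)] by (simp only: mult.commute[of t s])
  qed (simp add: S_def bij_mult_automaton(2)[OF assms(1,2)])
  then show ?thesis
    using continuous_mult_automaton[OF assms(1,2)]
    by (simp add: int_iterate_def continuous_map_funpow)
qed

lemma int_iterate_add_one:
  assumes "bij_betw F S S" "x \<in> S"
  shows "int_iterate S F (k + 1) x = F (int_iterate S F k x)"
proof (cases "0 \<le> k")
  case True
  then show ?thesis by (simp add: int_iterate_def nat_add_distrib)
next
  case False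
  define m where "m = nat (- k - 1)"
  have k: "nat (- k) = Suc m" "k = - 1 - int m"
    using False by (auto simp: m_def)
  have "bij_betw (inv_into S F ^^ m) S S"
    using assms(1) bij_betw_inv_into bij_betw_funpow by blast
  then have "(inv_into S F ^^ m) x \<in> F ` S"
    using assms by (auto simp: bij_betw_def)
  then have "F (int_iterate S F k x) = (inv_into S F ^^ m) x"
    using False k by (simp add: int_iterate_def f_inv_into_f)
  \<comment> \<open>The case \<open>m = 0\<close> is \<open>k = -1\<close>: then
    \<open>k + 1 = 0\<close> falls into the nonnegative branch of \<open>int_iterate\<close>, where
    both sides are \<open>x\<close>.\<close>
  also have "\<dots> = int_iterate S F (k + 1) x"
    by (cases m) (simp_all add: int_iterate_def k(2) nat_add_distrib)
  finally show ?thesis by simp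
qed

lemma continuous_trace_seq:
  assumes "s > 0" "t > 0"
  shows "continuous_map (full_shift (digits (s * t))) (full_shift (digits (s * t))) (trace_seq s t)"
proof -
  let ?A = "digits (s * t)"
  have proj: "continuous_map (full_shift ?A) (discrete_topology ?A) (\<lambda>x. x 0)"
    unfolding full_shift_def by (rule continuous_map_product_projection) simp
  have "continuous_map (full_shift ?A) (discrete_topology ?A) (\<lambda>x. trace_seq s t x k)" for k
    using continuous_map_compose[OF continuous_int_iterate[OF assms, of k] proj]
    by (simp add: trace_seq_def o_def)
  then have "continuous_map (full_shift ?A) (product_topology (\<lambda>_. discrete_topology ?A) UNIV) (trace_seq s t)"
    by (simp add: continuous_map_componentwise_UNIV)
  then show ?thesis by (simp add: full_shift_def)
qed

section \<open>Expansions of real numbers\<close>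

text \<open>The base-\<open>n\<close> expansion with the units digit at index 0. Larger indices are
  less significant: index \<open>i\<close> has weight \<open>n powi (- i)\<close>.\<close>

definition base_rep :: "int \<Rightarrow> real \<Rightarrow> int \<Rightarrow> int" where
  "base_rep n \<xi> = (\<lambda>i. \<lfloor>of_int n powi i * \<xi>\<rfloor> mod n)"

lemma base_rep_digit: "n > 0 \<Longrightarrow> base_rep n \<xi> \<in> topspace (full_shift (digits n))"
  by (simp add: base_rep_def topspace_full_shift_iff digits_def)

lemma base_rep_zero: "base_rep n \<xi> 0 = \<lfloor>\<xi>\<rfloor> mod n"
  by (simp add: base_rep_def)

lemma floor_divide_int: "t > 0 \<Longrightarrow> \<lfloor>\<xi> / of_int t\<rfloor> = \<lfloor>\<xi>\<rfloor> div t" for \<xi> :: real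
  using floor_divide_real_eq_div[of t \<xi>] by simp

text \<open>The floors of \<zeta> and of s \<zeta> are the quotients of \<open>N\<close> by
  \<open>s * t\<close> and by \<open>t\<close>, so only integer digit arithmetic remains. The
  meaning is that one layer of the automaton multiplies by \<open>s\<close>: two adjacent digits of
  a number give one digit of its \<open>s\<close>-fold.\<close>

lemma mult_g_floor:
  fixes \<zeta> :: real
  assumes "s > 0" "t > 0"
  shows "mult_g s t (\<lfloor>\<zeta>\<rfloor> mod (s * t)) (\<lfloor>of_int (s * t) * \<zeta>\<rfloor> mod (s * t)) = \<lfloor>of_int s * \<zeta>\<rfloor> mod (s * t)"
proof -
  define N where "N = \<lfloor>of_int (s * t) * \<zeta>\<rfloor>"
  have n: "s * t > 0" using assms by simp
  have "\<lfloor>\<zeta>\<rfloor> = N div (s * t)"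
    using floor_divide_int[OF n, of "of_int (s * t) * \<zeta>"] assms by (simp add: N_def)
  moreover have "\<lfloor>of_int s * \<zeta>\<rfloor> = N div t"
    using floor_divide_int[of t "of_int (s * t) * \<zeta>"] assms by (simp add: N_def)
  moreover have "N div (s * t) = N div t div s"
    using assms by (metis mult.commute zdiv_zmult2_eq less_imp_le)
  moreover have "N mod (s * t) div t = N div t mod s"
    using assms zmod_zmult2_eq[of s N t] by (simp add: mult.commute)
  \<comment> \<open>Mixed-radix splitting of the residue: low part modulo \<open>s\<close>, high
    part modulo \<open>t\<close>, which are the two halves that \<open>mult_g\<close> puts
    together.\<close>
  moreover have "N div t mod (s * t) = s * (N div t div s mod t) + N div t mod s"
    using assms by (simp add: zmod_zmult2_eq)
  moreover have "a mod (s * t) mod t = a mod t" for a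
    by (simp add: mod_mod_cancel)
  ultimately show ?thesis
    unfolding mult_g_def N_def[symmetric] by (simp add: mult.commute)
qed

text \<open>Two layers multiply by \<open>s * s\<close>. They produce the digit of index
  \<open>i - 1\<close> but store it at index \<open>i\<close>, which divides by \<open>s * t\<close>
  and leaves the factor \<open>s / t\<close>.\<close>

lemma mult_automaton_base_rep:
  assumes "s > 0" "t > 0"
  shows "mult_automaton s t (base_rep (s * t) \<xi>) = base_rep (s * t) (of_int s / of_int t * \<xi>)"
proof
  fix i
  define n where "n = s * t"
  define \<zeta> where "\<zeta> = of_int n powi (i - 1) * \<xi>"
  have n: "real_of_int n \<noteq> 0" using assms by (simp add: n_def)
  have i: "real_of_int n powi i = of_int n * of_int n powi (i - 1)"
    using n power_int_add_1'[of "real_of_int n" "i - 1"] by simp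
  have i1: "real_of_int n powi (i + 1) = of_int n * (of_int n * of_int n powi (i - 1))"
    using n i power_int_add_1'[of "real_of_int n" i] by simp
  have g0: "mult_g s t (\<lfloor>\<zeta>\<rfloor> mod n) (\<lfloor>of_int n * \<zeta>\<rfloor> mod n) = \<lfloor>of_int s * \<zeta>\<rfloor> mod n"
    using mult_g_floor[OF assms, of \<zeta>] by (simp add: n_def)
  have g1: "mult_g s t (\<lfloor>of_int n * \<zeta>\<rfloor> mod n) (\<lfloor>of_int n * (of_int n * \<zeta>)\<rfloor> mod n)
      = \<lfloor>of_int n * (of_int s * \<zeta>)\<rfloor> mod n"
    using mult_g_floor[OF assms, of "of_int n * \<zeta>"] by (simp add: n_def mult_ac)
  have "mult_automaton s t (base_rep n \<xi>) i = \<lfloor>of_int s * (of_int s * \<zeta>)\<rfloor> mod n"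
    using g0 g1 mult_g_floor[OF assms, of "of_int s * \<zeta>"]
    by (simp add: mult_automaton_def mult_f_def base_rep_def i i1 \<zeta>_def mult.assoc n_def[symmetric])
  also have "of_int s * (of_int s * \<zeta>) = of_int n powi i * (of_int s / of_int t * \<xi>)"
    using assms by (simp add: i \<zeta>_def) (simp add: n_def)
  finally show "mult_automaton s t (base_rep (s * t) \<xi>) i
      = base_rep (s * t) (of_int s / of_int t * \<xi>) i"
    by (simp add: base_rep_def n_def)
qed

text \<open>Backward steps are steps of the swapped automaton, which multiplies by
  \<open>t / s\<close>.\<close>

lemma int_iterate_base_rep:
  assumes "s > 0" "t > 0"
  shows "int_iterate (topspace (full_shift (digits (s * t)))) (mult_automaton s t) k (base_rep (s * t) \<xi>)
    = base_rep (s * t) ((of_int s / of_int t) powi k * \<xi>)"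
proof -
  let ?S = "topspace (full_shift (digits (s * t)))" and ?r = "real_of_int s / of_int t"
  have pos: "(mult_automaton s t ^^ m) (base_rep (s * t) \<xi>) = base_rep (s * t) (?r ^ m * \<xi>)" for m
    by (induction m) (simp_all add: mult_automaton_base_rep[OF assms] mult.assoc)
  have "(inv_into ?S (mult_automaton s t) ^^ m) (base_rep (s * t) \<xi>)
      = base_rep (s * t) (inverse ?r ^ m * \<xi>)" for m
    using assms bij_mult_automaton(2)[OF assms base_rep_digit] mult_automaton_base_rep[of t s]
    by (induction m) (simp_all add: mult.assoc mult.commute[of t s])
  with pos show ?thesis
    by (simp add: int_iterate_def power_int_def)
qed

lemma trace_seq_base_rep:
  assumes "s > 0" "t > 0"
  shows "trace_seq s t (base_rep (s * t) \<xi>) k = \<lfloor>(of_int s / of_int t) powi k * \<xi>\<rfloor> mod (s * t)"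
  by (simp add: trace_seq_def int_iterate_base_rep[OF assms] base_rep_zero)

lemma Phi_trace_seq_base_rep:
  assumes "p > 0" "q > 0"
  shows "Phi p q (trace_seq p q (base_rep (p * q) \<xi>)) = companion_rep p q \<xi>"
proof
  fix i
  define \<zeta> where "\<zeta> = (of_int p / of_int q) powi i * \<xi>"
  define \<eta> where "\<eta> = of_int p / of_int q * \<zeta>"
  have \<eta>: "(of_int p / of_int q) powi (i + 1) * \<xi> = \<eta>"
    using assms by (simp add: power_int_add_1' \<zeta>_def \<eta>_def)
  have "\<eta> / of_int p = \<zeta> / of_int q" using assms by (simp add: \<eta>_def)
  then have div: "\<lfloor>\<eta>\<rfloor> div p = \<lfloor>\<zeta>\<rfloor> div q"
    using floor_divide_int assms by metis
  have "Phi p q (trace_seq p q (base_rep (p * q) \<xi>)) i = q * (\<lfloor>\<eta>\<rfloor> mod p) - p * (\<lfloor>\<zeta>\<rfloor> mod q)"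
    using \<eta> by (simp add: Phi_def trace_seq_base_rep[OF assms] mod_mod_cancel flip: \<zeta>_def)
  \<comment> \<open>Replacing residues by full floors adds \<open>q * p\<close> times the quotient
    of \<lfloor>\<eta>\<rfloor> by \<open>p\<close> and subtracts \<open>p * q\<close> times that of
    \<lfloor>\<zeta>\<rfloor> by \<open>q\<close>; these cancel by \<open>div\<close>.\<close>
  also have "\<dots> = q * \<lfloor>\<eta>\<rfloor> - p * \<lfloor>\<zeta>\<rfloor>"
    using div by (simp add: minus_div_mult_eq_mod[symmetric] algebra_simps)
  finally show "Phi p q (trace_seq p q (base_rep (p * q) \<xi>)) i = companion_rep p q \<xi> i"
    by (simp add: companion_rep_def companion_digit_def \<eta>_def \<zeta>_def)
qed

section \<open>Density of the expansions in the full shift\<close>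

lemma exists_int_with_digits:
  fixes n :: int
  assumes "n > 0" "\<And>j. d j \<in> digits n"
  shows "\<exists>N>0. \<forall>j<k. N div n ^ j mod n = d j"
  using assms(2)
proof (induction k arbitrary: d)
  case 0
  \<comment> \<open>Starting from 1 puts a nonzero digit above the prescribed ones, so
    \<open>N\<close> stays positive even if these all vanish. The inductive step is Horner's scheme
    with \<open>d 0\<close> as lowest digit.\<close>
  show ?case by (rule exI[of _ 1]) simp
next
  case (Suc k)
  obtain N where N: "N > 0" "\<And>j. j < k \<Longrightarrow> N div n ^ j mod n = d (Suc j)"
    using Suc.IH[of "\<lambda>j. d (Suc j)"] Suc.prems by auto
  have d: "0 \<le> d 0" "d 0 < n" using Suc.prems[of 0] by (auto simp: digits_def)
  have "(N * n + d 0) div n ^ Suc j = N div n ^ j" for j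
    using d \<open>n > 0\<close> by (simp add: zdiv_zmult2_eq)
  then have "(N * n + d 0) div n ^ j mod n = d j" if "j < Suc k" for j
    using N(2) d that by (cases j) auto
  moreover have "N * n + d 0 > 0" using N d \<open>n > 0\<close> by (simp add: add_pos_nonneg)
  ultimately show ?case by blast
qed

text \<open>A neighbourhood of \<open>x\<close> constrains only a finite window, and a suitably
  scaled positive integer can have any prescribed digits there.\<close>

lemma dense_base_rep:
  assumes "n > 0"
  shows "full_shift (digits n) closure_of (base_rep n ` {0<..}) = topspace (full_shift (digits n))"
proof
  show "topspace (full_shift (digits n)) \<subseteq> full_shift (digits n) closure_of (base_rep n ` {0<..})"
  proof (clarsimp simp: in_closure_of)
    fix x T
    assume x: "x \<in> topspace (full_shift (digits n))" and T: "x \<in> T" "openin (full_shift (digits n)) T"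
    obtain J where J: "finite J"
      "\<And>y. y \<in> topspace (full_shift (digits n)) \<Longrightarrow> \<forall>j\<in>J. y j = x j \<Longrightarrow> y \<in> T"
      using cylinder_in_open[OF T(2,1)] by blast
    obtain m :: int where "J \<subseteq> {-m..m}"
    proof -
      have "\<bar>j\<bar> \<le> Max (insert 0 (abs ` J))" if "j \<in> J" for j
        using J(1) that by (intro Max_ge) auto
      then have "j \<in> {- Max (insert 0 (abs ` J))..Max (insert 0 (abs ` J))}" if "j \<in> J" for j
        using that by (fastforce simp: abs_le_iff)
      then show ?thesis using that by blast
    qed
    \<comment> \<open>Digits of an integer are counted from the right, so index \<open>i\<close> of
      the window corresponds to \<open>j = m - i\<close>; the window has \<open>2 * m + 1\<close>
      positions.\<close>
    obtain N where N: "N > 0" "\<And>j. j < nat (2 * m + 1) \<Longrightarrow> N div n ^ j mod n = x (m - int j)"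
      using exists_int_with_digits[OF assms, of "\<lambda>j. x (m - int j)" "nat (2 * m + 1)"] x
      by (auto simp: topspace_full_shift_iff)
    \<comment> \<open>The factor moves the last digit of \<open>N\<close> from index 0 to index
      \<open>m\<close>.\<close>
    define \<xi> where "\<xi> = real_of_int N * of_int n powi (- m)"
    have "base_rep n \<xi> i = x i" if "i \<in> J" for i
    proof -
      have i: "- m \<le> i" "i \<le> m" using that \<open>J \<subseteq> _\<close> by auto
      define j where "j = nat (m - i)"
      have "real_of_int n powi i * \<xi> = of_int N * (of_int n powi (- int j))"
        using assms i by (simp add: \<xi>_def j_def power_int_diff power_int_minus field_simps)
      also have "\<dots> = of_int N / of_int (n ^ j)"
        by (simp add: power_int_minus field_simps)
      finally have "\<lfloor>real_of_int n powi i * \<xi>\<rfloor> = N div n ^ j"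
        by (metis floor_divide_of_int_eq)
      then show ?thesis using N(2)[of j] i by (simp add: base_rep_def j_def)
    qed
    then have "base_rep n \<xi> \<in> T" using J(2) base_rep_digit[OF assms] by blast
    moreover have "\<xi> > 0" using N(1) assms by (simp add: \<xi>_def)
    ultimately show "\<exists>\<xi>\<in>{0<..}. base_rep n \<xi> \<in> T" by auto
  qed
qed (rule closure_of_subset_topspace)

section \<open>The conjugacy\<close>

text \<open>On arbitrary sequences over \<open>digits (p * q)\<close> the values of
  \<open>Phi\<close> reach \<open>q * (p - 1)\<close>. On a trace, consecutive entries share the
  intermediate symbol \<open>g\<close>, and \<open>Phi\<close> becomes a difference of a digit below
  \<open>p\<close> and a digit below \<open>q\<close>.\<close>

lemma Phi_trace_seq_signed_digits:
  assumes "p > 0" "q > 0" and x: "x \<in> topspace (full_shift (digits (p * q)))"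
  shows "Phi p q (trace_seq p q x) i \<in> signed_digits p q"
proof -
  let ?S = "topspace (full_shift (digits (p * q)))"
  define y where "y = int_iterate ?S (mult_automaton p q) i x"
  have "y \<in> ?S"
    unfolding y_def using continuous_map_image_subset_topspace[OF continuous_int_iterate[OF assms(1,2)]] x
    by blast
  then have y: "y j \<in> digits (p * q)" for j by (simp add: topspace_full_shift_iff)
  have "trace_seq p q x (i + 1) = mult_automaton p q y 0"
    using int_iterate_add_one[OF bij_mult_automaton(1)[OF assms(1,2)] x]
    by (simp add: trace_seq_def y_def)
  moreover define g where "g = mult_g p q (y 0) (y 1)"
  ultimately have "trace_seq p q x (i + 1) mod p = g div q"
    using mult_g_digit assms y by (simp add: mult_automaton_def mult_f_def)
  moreover have "trace_seq p q x i = y 0" by (simp add: trace_seq_def y_def)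
  moreover have "p * (y 0 mod q) = g - y 1 div q" by (simp add: g_def mult_g_def)
  ultimately have "Phi p q (trace_seq p q x) i = y 1 div q - g mod q"
    by (simp add: Phi_def minus_mult_div_eq_mod[symmetric])
  moreover have "0 \<le> y 1 div q" "y 1 div q < p"
    using mult_g_digit(3)[OF assms(1,2) y[of 1]] assms(1)
    by (metis pos_mod_sign, metis pos_mod_bound)
  moreover have "0 \<le> g mod q" "g mod q < q" using assms by auto
  ultimately show ?thesis by (simp add: signed_digits_def)
qed

lemma inj_on_Phi:
  assumes "coprime p q" "p > 0" "q > 0"
  shows "inj_on (Phi p q) (topspace (full_shift (digits (p * q))))"
proof (rule inj_onI)
  fix x y
  assume x: "x \<in> topspace (full_shift (digits (p * q)))"
    and y: "y \<in> topspace (full_shift (digits (p * q)))"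
    and eq: "Phi p q x = Phi p q y"
  have i: "x i mod q = y i mod q \<and> x (i + 1) mod p = y (i + 1) mod p" for i
  proof -
    have e: "q * (x (i + 1) mod p - y (i + 1) mod p) = p * (x i mod q - y i mod q)"
      using fun_cong[OF eq, of i] by (simp add: Phi_def algebra_simps)
    \<comment> \<open>Coprimality moves the divisor \<open>q\<close> onto a difference of residues
      modulo \<open>q\<close>, which forces them to be equal; equation \<open>e\<close> then gives
      equality modulo \<open>p\<close>.\<close>
    then have "q dvd p * (x i mod q - y i mod q)" by (metis dvd_triv_left)
    then have "q dvd x i mod q - y i mod q"
      using assms(1) by (simp add: coprime_dvd_mult_right_iff coprime_commute)
    then have "x i mod q = y i mod q" by (metis mod_eq_dvd_iff mod_mod_trivial)
    with e assms show ?thesis by simp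
  qed
  show "x = y"
  proof
    fix i
    have "q dvd x i - y i" using i[of i] by (simp add: mod_eq_dvd_iff)
    \<comment> \<open>The residue of entry \<open>i\<close> modulo \<open>p\<close> is read off at
      index \<open>i - 1\<close>, since \<open>Phi\<close> looks one step ahead there.\<close>
    moreover have "p dvd x i - y i" using i[of "i - 1"] by (simp add: mod_eq_dvd_iff)
    ultimately have "p * q dvd x i - y i" using assms(1) by (simp add: divides_mult)
    then have "x i mod (p * q) = y i mod (p * q)" by (simp add: mod_eq_dvd_iff)
    then show "x i = y i" using x y by (simp add: topspace_full_shift_iff digits_def)
  qed
qed

lemma continuous_Phi:
  assumes "X \<subseteq> topspace (full_shift A)" "\<And>x i. x \<in> X \<Longrightarrow> Phi p q x i \<in> B"
  shows "continuous_map (subtopology (full_shift A) X) (full_shift B) (Phi p q)"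
proof (rule continuous_map_local[OF assms])
  show "\<exists>J. finite J \<and> (\<forall>x\<in>X. \<forall>y\<in>X. (\<forall>j\<in>J. x j = y j) \<longrightarrow> Phi p q x i = Phi p q y i)" for i
    by (rule exI[of _ "{i, i + 1}"]) (simp add: Phi_def)
qed

text \<open>One inclusion: a continuous map sends the closure of the expansions, which is the whole
  full shift, into the closure of their images. The other: the image of a compact space in a
  Hausdorff space is closed, and it contains all companion representations.\<close>

lemma Phi_image_trace_subshift:
  assumes "p > 0" "q > 0"
    and cont: "continuous_map (subtopology (full_shift (digits (p * q))) (trace_subshift p q))
      (full_shift (signed_digits p q)) (Phi p q)"
  shows "Phi p q ` trace_subshift p q = companion_subshift p q"
proof -
  let ?D = "full_shift (digits (p * q))" and ?B = "full_shift (signed_digits p q)"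
  let ?h = "Phi p q \<circ> trace_seq p q" and ?R = "base_rep (p * q) ` {0<..}"
  have "continuous_map ?D (subtopology ?D (trace_subshift p q)) (trace_seq p q)"
    using continuous_trace_seq[OF assms(1,2)]
    by (auto simp: continuous_map_in_subtopology trace_subshift_def)
  then have h: "continuous_map ?D ?B ?h" using cont continuous_map_compose by blast
  have R: "?h ` ?R = companion_rep p q ` {0<..}"
    by (simp add: image_image Phi_trace_seq_base_rep[OF assms(1,2)])
  have D: "Phi p q ` trace_subshift p q = ?h ` topspace ?D"
    by (simp add: trace_subshift_def image_comp)
  have "?h ` topspace ?D \<subseteq> companion_subshift p q"
    using continuous_map_image_closure_subset[OF h, of ?R] dense_base_rep[of "p * q"] R assms(1,2)
    by (simp add: companion_subshift_def)
  moreover have "companion_subshift p q \<subseteq> ?h ` topspace ?D"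
    unfolding companion_subshift_def
  proof (rule closure_of_minimal)
    show "companion_rep p q ` {0<..} \<subseteq> ?h ` topspace ?D"
      unfolding R[symmetric] using base_rep_digit[of "p * q"] assms(1,2) by (intro image_mono) auto
    have "compactin ?D (topspace ?D)"
      using compact_full_shift[of "digits (p * q)"] by (simp add: compact_space_def digits_def)
    then show "closedin ?B (?h ` topspace ?D)"
      using h image_compactin compactin_imp_closedin Hausdorff_full_shift by blast
  qed
  ultimately show ?thesis using D by blast
qed

theorem theorem3p7:
  fixes p q :: int
  assumes "coprime p q" and "p > q" and "q > 1"
  shows "conjugacy (digits (p * q)) (trace_subshift p q)
           (signed_digits p q) (companion_subshift p q) (Phi p q)"
proof -
  have pos: "p > 0" "q > 0" using assms by auto
  have X: "trace_subshift p q \<subseteq> topspace (full_shift (digits (p * q)))"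
    unfolding trace_subshift_def
    by (rule continuous_map_image_subset_topspace[OF continuous_trace_seq[OF pos]])
  have cont: "continuous_map (subtopology (full_shift (digits (p * q))) (trace_subshift p q))
      (full_shift (signed_digits p q)) (Phi p q)"
    using X Phi_trace_seq_signed_digits[OF pos]
    by (intro continuous_Phi) (auto simp: trace_subshift_def)
  note image = Phi_image_trace_subshift[OF pos cont]
  have "companion_subshift p q \<subseteq> topspace (full_shift (signed_digits p q))"
    by (simp add: companion_subshift_def closure_of_subset_topspace)
  moreover have "bij_betw (Phi p q) (trace_subshift p q) (companion_subshift p q)"
    using inj_on_subset[OF inj_on_Phi[OF assms(1) pos] X] image by (simp add: bij_betw_def)
  moreover have "continuous_map (subtopology (full_shift (digits (p * q))) (trace_subshift p q))
      (subtopology (full_shift (signed_digits p q)) (companion_subshift p q)) (Phi p q)"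
    using cont image by (auto simp: continuous_map_in_subtopology)
  \<comment> \<open>Commutation with the shift is immediate on unfolding, as \<open>Phi\<close>
    applies the same local rule at every index.\<close>
  ultimately show ?thesis
    using X by (simp add: conjugacy_def Phi_def shift_def)
qed

end
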